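(* Let $\vec n_1^*,\vec n_2^*,\vec n_3^*\in\mathbb{R}^3$ be unit vectors such that $\vec n_i^*\cdot\vec n_j^*=-1$ for at most one of the pairs $(i,j)\in\{(1,2),(1,3),(2,3)\}$ and $|\vec n_i^*\cdot\vec n_j^*|<1$ for the remaining pairs. For each such pair let $\omega_{ij}\in[0,1]$ be the solution of $$\vec n_i^*\cdot\vec n_j^*=\frac{2\omega_{ij}-1}{\omega_{ij}^2+(1-\omega_{ij})^2}.$$ Let $Q_{\max}$ be the maximum of the witness $I_6(\omega_{12},\omega_{13},\omega_{23})$ over all six-tuples of qubit states $\rho_1,\dots,\rho_6$ and all six-tuples of two-outcome qubit observables $B_1,\dots,B_6$. Then $$Q_{\max}=\sum_{(i,j)\in\{(1,2),(1,3),(2,3)\}}\left(2\sqrt{\omega_{ij}^2+(1-\omega_{ij})^2}+\omega_{ij}\right),$$ and this value self-tests the target triple: whenever $(\rho_1,\dots,\rho_6,B_1,\dots,B_6)$ attains $I_6(\omega_{12},\omega_{13},\omega_{23})=Q_{\max}$, the states $\rho_1,\rho_2,\rho_3$ are pure and their Bloch vectors satisfy $\vec n_i\cdot\vec n_j=\vec n_i^*\cdot\vec n_j^*$ for all $1\le i<j\le 3$.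
   Context: A qubit state is a density matrix $\rho=\tfrac12(\mathbb{I}_2+\vec n\cdot\vec\sigma)$ with Bloch vector $\vec n\in\mathbb{R}^3$, $|\vec n|\le 1$ ($\vec\sigma$ is the vector of Pauli matrices); it is pure iff $|\vec n|=1$. A two-outcome qubit observable is $B=M_0-M_1$, where $M_0,M_1$ are positive semidefinite $2\times2$ matrices with $M_0+M_1=\mathbb{I}_2$ (equivalently, $B$ Hermitian with $-\mathbb{I}_2\preceq B\preceq\mathbb{I}_2$). Given states $\rho_x$ and observables $B_y$, put $E_{x,y}=\mathrm{Tr}(\rho_xB_y)$. For $\omega\in[0,1]$ define $$I_3(\omega;i_1,i_2,i_3,j_1,j_2)=\omega(E_{i_1,j_1}+E_{i_2,j_1}-E_{i_3,j_1})+(1-\omega)(E_{i_1,j_2}-E_{i_2,j_2}),$$ and $$I_6(\omega_{12},\omega_{13},\omega_{23})=I_3(\omega_{12};1,2,4,1,2)+I_3(\omega_{13};1,3,5,3,4)+I_3(\omega_{23};2,3,6,5,6).$$ The map $\omega\mapsto\frac{2\omega-1}{\omega^2+(1-\omega)^2}$ is strictly increasing from $-1$ to $1$ on $[0,1]$, so each $\omega_{ij}$ is well defined and unique. *)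

theory Defs
  imports "HOL-Analysis.Analysis"
begin

definition adj_mat :: "complex^2^2 \<Rightarrow> complex^2^2" where
  "adj_mat A = (\<chi> i j. cnj (A $ j $ i))"

text \<open>For a Hermitian matrix the quadratic form is real valued, so taking the real part loses
  nothing.\<close>

definition pos_semidef :: "complex^2^2 \<Rightarrow> bool" where
  "pos_semidef A \<longleftrightarrow>
     adj_mat A = A \<and> (\<forall>v :: complex^2. 0 \<le> Re (\<Sum>i\<in>UNIV. cnj (v $ i) * (A *v v) $ i))"

definition pauli_x :: "complex^2^2" where
  "pauli_x = vector [vector [0, 1], vector [1, 0]]"

definition pauli_y :: "complex^2^2" where
  "pauli_y = vector [vector [0, - \<i>], vector [\<i>, 0]]"

definition pauli_z :: "complex^2^2" where
  "pauli_z = vector [vector [1, 0], vector [0, - 1]]"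

definition bloch_state :: "real^3 \<Rightarrow> complex^2^2" where
  "bloch_state n =
     (1/2) *\<^sub>R (mat 1 + (n $ 1 *\<^sub>R pauli_x + n $ 2 *\<^sub>R pauli_y + n $ 3 *\<^sub>R pauli_z))"

definition qubit_state :: "complex^2^2 \<Rightarrow> bool" where
  "qubit_state \<rho> \<longleftrightarrow> (\<exists>n. norm n \<le> 1 \<and> \<rho> = bloch_state n)"

definition bloch_vector :: "complex^2^2 \<Rightarrow> real^3" where
  "bloch_vector \<rho> = (THE n. \<rho> = bloch_state n)"

definition pure_state :: "complex^2^2 \<Rightarrow> bool" where
  "pure_state \<rho> \<longleftrightarrow> (\<exists>\<psi> :: complex^2. norm \<psi> = 1 \<and> \<rho> = (\<chi> i j. \<psi> $ i * cnj (\<psi> $ j)))"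

definition two_outcome_observable :: "complex^2^2 \<Rightarrow> bool" where
  "two_outcome_observable B \<longleftrightarrow>
     (\<exists>M0 M1. pos_semidef M0 \<and> pos_semidef M1 \<and> M0 + M1 = mat 1 \<and> B = M0 - M1)"

text \<open>The trace is real for the states and observables considered here.\<close>

definition expectation_table ::
    "(nat \<Rightarrow> complex^2^2) \<Rightarrow> (nat \<Rightarrow> complex^2^2) \<Rightarrow> nat \<Rightarrow> nat \<Rightarrow> real" where
  "expectation_table \<rho> B x y = Re (trace (\<rho> x ** B y))"

definition I3 :: "(nat \<Rightarrow> nat \<Rightarrow> real) \<Rightarrow> real \<Rightarrow> nat \<Rightarrow> nat \<Rightarrow> nat \<Rightarrow> nat \<Rightarrow> nat \<Rightarrow> real" where
  "I3 E w i1 i2 i3 j1 j2 =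
     w * (E i1 j1 + E i2 j1 - E i3 j1) + (1 - w) * (E i1 j2 - E i2 j2)"

definition I6 :: "(nat \<Rightarrow> nat \<Rightarrow> real) \<Rightarrow> real \<Rightarrow> real \<Rightarrow> real \<Rightarrow> real" where
  "I6 E w12 w13 w23 = I3 E w12 1 2 4 1 2 + I3 E w13 1 3 5 3 4 + I3 E w23 2 3 6 5 6"

text \<open>Six-tuples are functions on \<^typ>\<open>nat\<close> of which only the values at 1, ..., 6 matter.\<close>

definition qubit_realization ::
    "(nat \<Rightarrow> complex^2^2) \<Rightarrow> (nat \<Rightarrow> complex^2^2) \<Rightarrow> bool" where
  "qubit_realization \<rho> B \<longleftrightarrow>
     (\<forall>x\<in>{1..6}. qubit_state (\<rho> x)) \<and> (\<forall>y\<in>{1..6}. two_outcome_observable (B y))"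

definition witness_values :: "real \<Rightarrow> real \<Rightarrow> real \<Rightarrow> real set" where
  "witness_values w12 w13 w23 =
     {I6 (expectation_table \<rho> B) w12 w13 w23 | \<rho> B. qubit_realization \<rho> B}"

text \<open>\<^const>\<open>Greatest\<close> is unspecified when there is no greatest element, so a statement about
  this constant has to assert separately that the maximum exists.\<close>

definition Q_max :: "real \<Rightarrow> real \<Rightarrow> real \<Rightarrow> real" where
  "Q_max w12 w13 w23 = (GREATEST q. q \<in> witness_values w12 w13 w23)"

definition index_pairs :: "(nat \<times> nat) set" where
  "index_pairs = {(1, 2), (1, 3), (2, 3)}"

lemma bloch_state_entries:
  "bloch_state n $ 1 $ 1 = complex_of_real ((1 + n $ 3) / 2)"
  "bloch_state n $ 1 $ 2 = Complex (n $ 1 / 2) (- n $ 2 / 2)"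
  "bloch_state n $ 2 $ 1 = Complex (n $ 1 / 2) (n $ 2 / 2)"
  "bloch_state n $ 2 $ 2 = complex_of_real ((1 - n $ 3) / 2)"
  by (auto simp: bloch_state_def pauli_x_def pauli_y_def pauli_z_def mat_def complex_eq_iff)

lemma bloch_state_inject: "bloch_state m = bloch_state n \<longleftrightarrow> m = n"
proof
  assume "bloch_state m = bloch_state n"
  then have "bloch_state m $ 1 $ 1 = bloch_state n $ 1 $ 1"
    "bloch_state m $ 2 $ 1 = bloch_state n $ 2 $ 1" by auto
  then show "m = n"
    by (auto simp: bloch_state_entries vec_eq_iff forall_3)
qed simp

lemma bloch_vector_bloch_state [simp]: "bloch_vector (bloch_state n) = n"
  by (auto simp: bloch_vector_def bloch_state_inject)

lemma norm_bloch_eq_1: "norm (n :: real^3) = 1 \<longleftrightarrow> (n $ 1)\<^sup>2 + (n $ 2)\<^sup>2 + (n $ 3)\<^sup>2 = 1"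
  by (simp add: norm_vec_def L2_set_def sum_3)

lemma norm_ket_eq_1:
  "norm (\<psi> :: complex^2) = 1 \<longleftrightarrow> (cmod (\<psi> $ 1))\<^sup>2 + (cmod (\<psi> $ 2))\<^sup>2 = 1"
  by (simp add: norm_vec_def L2_set_def sum_2)

lemma pure_state_bloch_state: "pure_state (bloch_state n) \<longleftrightarrow> norm n = 1"
proof
  assume "pure_state (bloch_state n)"
  then obtain \<psi> :: "complex^2" where psi: "norm \<psi> = 1"
    and eq: "bloch_state n = (\<chi> i j. \<psi> $ i * cnj (\<psi> $ j))"
    by (auto simp: pure_state_def)
  obtain a b where a: "\<psi> $ 1 = Complex a b" by (cases "\<psi> $ 1")
  obtain c d where c: "\<psi> $ 2 = Complex c d" by (cases "\<psi> $ 2")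
  have "bloch_state n $ 1 $ 1 = \<psi> $ 1 * cnj (\<psi> $ 1)"
    "bloch_state n $ 2 $ 1 = \<psi> $ 2 * cnj (\<psi> $ 1)"
    "bloch_state n $ 2 $ 2 = \<psi> $ 2 * cnj (\<psi> $ 2)"
    by (simp_all add: eq)
  then have "1 + n $ 3 = 2 * (a\<^sup>2 + b\<^sup>2)" "n $ 1 = 2 * (a * c + b * d)"
    "n $ 2 = 2 * (a * d - b * c)" "1 - n $ 3 = 2 * (c\<^sup>2 + d\<^sup>2)"
    by (auto simp: bloch_state_entries a c complex_eq_iff power2_eq_square algebra_simps)
  then have "(n $ 1)\<^sup>2 + (n $ 2)\<^sup>2 = (1 + n $ 3) * (1 - n $ 3)"
    by (simp only:) (simp add: power2_eq_square algebra_simps)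
  then show "norm n = 1"
    by (simp add: norm_bloch_eq_1 power2_eq_square algebra_simps)
next
  assume "norm n = 1"
  then have n: "(n $ 1)\<^sup>2 + (n $ 2)\<^sup>2 = (1 + n $ 3) * (1 - n $ 3)"
    by (simp add: norm_bloch_eq_1 power2_eq_square algebra_simps)
  have ge: "- 1 \<le> n $ 3"
    using component_le_norm_cart[of n 3] \<open>norm n = 1\<close> by simp
  define r where "r = sqrt ((1 + n $ 3) / 2)"
  define \<psi> :: "complex^2" where
    "\<psi> = (if n $ 3 = - 1 then vector [0, 1]
           else vector [of_real r, Complex (n $ 1 / (2 * r)) (n $ 2 / (2 * r))])"
  have r2: "r * r = (1 + n $ 3) / 2"
    using ge by (simp add: r_def)
  have eq: "bloch_state n $ i $ j = \<psi> $ i * cnj (\<psi> $ j)" for i j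
  proof (cases "n $ 3 = - 1")
    case True
    then have "n $ 1 = 0" "n $ 2 = 0"
      using n by (auto simp: sum_power2_eq_zero_iff)
    then show ?thesis
      using exhaust_2[of i] exhaust_2[of j] True
      by (auto simp: \<psi>_def bloch_state_entries complex_eq_iff)
  next
    case False
    then have r: "r \<noteq> 0" "1 + n $ 3 \<noteq> 0" using ge by (auto simp: r_def)
    have "n $ 1 / (2 * r) * (n $ 1 / (2 * r)) + n $ 2 / (2 * r) * (n $ 2 / (2 * r))
        = ((n $ 1)\<^sup>2 + (n $ 2)\<^sup>2) / (4 * (r * r))"
      by (simp add: power2_eq_square add_divide_distrib)
    also have "\<dots> = (1 - n $ 3) / 2"
      using r by (simp add: n r2 field_simps)
    finally show ?thesis
      using exhaust_2[of i] exhaust_2[of j] False r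
      by (auto simp: \<psi>_def bloch_state_entries complex_eq_iff r2)
  qed
  have "of_real ((cmod (\<psi> $ 1))\<^sup>2 + (cmod (\<psi> $ 2))\<^sup>2)
      = bloch_state n $ 1 $ 1 + bloch_state n $ 2 $ 2"
    by (simp only: eq of_real_add complex_norm_square)
  also have "\<dots> = of_real 1"
    by (simp add: bloch_state_entries complex_eq_iff field_simps)
  finally have "norm \<psi> = 1"
    by (simp only: norm_ket_eq_1 of_real_eq_iff)
  with eq show "pure_state (bloch_state n)"
    unfolding pure_state_def by (auto simp: vec_eq_iff)
qed

end

(* An observable b0 I + b . sigma satisfies |b0| + |b| <= 1 and has expectation b0 + n . b in the
   state with Bloch vector n. Hence I3 for the states n1, n2, n3 is at most
   w + w |n1 + n2| + (1 - w) |n1 - n2|, and this value is attained at a suitable n3. As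
   |n1 + n2|^2 + |n1 - n2|^2 <= 4, the Cauchy-Schwarz inequality gives the bound
   w + 2 sqrt (w^2 + (1 - w)^2), with equality iff n1, n2 are unit vectors and
   |n1 + n2| : |n1 - n2| = w : (1 - w), which fixes n1 . n2. The three summands of I6 can be
   maximized simultaneously, so a maximizer of I6 maximizes each of them. *)

theory Submission
  imports Defs
begin

section \<open>Expectations of two-outcome observables in terms of Bloch vectors\<close>

lemma trace_bloch_state_affine:
  obtains m0 :: real and m :: "real^3"
  where "\<And>n. Re (trace (bloch_state n ** M)) = m0 + n \<bullet> m"
proof
  \<comment> \<open>The constant is half the real part of the trace of \<open>M\<close>; the
    components of the vector are half the real parts of the traces of \<open>M\<close> multiplied by
    the three Pauli matrices.\<close>
  show "Re (trace (bloch_state n ** M)) = (Re (M$1$1) + Re (M$2$2)) / 2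
      + n \<bullet> vector [(Re (M$2$1) + Re (M$1$2)) / 2, (Im (M$2$1) - Im (M$1$2)) / 2,
                     (Re (M$1$1) - Re (M$2$2)) / 2]" for n
    by (simp add: trace_def matrix_matrix_mult_def sum_2 sum_3 inner_vec_def bloch_state_entries
        field_simps)
qed

lemma trace_bloch_state: "trace (bloch_state n) = 1"
  by (simp add: trace_def sum_2 bloch_state_entries complex_eq_iff field_simps)

text \<open>For the projector onto a ket, the trace against \<open>M\<close> is the quadratic form
  of \<open>M\<close> at that ket.\<close>

lemma trace_pure_state_nonneg:
  assumes "pos_semidef M" "pure_state \<rho>"
  shows "0 \<le> Re (trace (\<rho> ** M))"
proof -
  obtain \<psi> :: "complex^2" where \<psi>: "\<rho> = (\<chi> i j. \<psi> $ i * cnj (\<psi> $ j))"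
    using assms(2) by (auto simp: pure_state_def)
  have "trace (\<rho> ** M) = (\<Sum>i\<in>UNIV. cnj (\<psi> $ i) * (M *v \<psi>) $ i)"
    by (simp add: \<psi> trace_def matrix_matrix_mult_def matrix_vector_mult_def sum_2 algebra_simps)
  with assms(1) show ?thesis by (simp add: pos_semidef_def)
qed

text \<open>A zero vector gets an arbitrary unit direction. An optimal observable along
  \<open>m1 + m2\<close> therefore exists even for antipodal states, where this sum
  vanishes.\<close>

lemma obtain_direction:
  fixes v :: "real^3"
  obtains u where "norm u = 1" "v = norm v *\<^sub>R u"
proof (cases "v = 0")
  case True
  then show ?thesis using that[of "axis 1 1"] by simp
next
  case False
  then show ?thesis using that[of "sgn v"] by (simp add: norm_sgn sgn_div_norm)
qed

text \<open>On the unit sphere the affine function is smallest at the direction opposite to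
  \<open>m\<close>, where its value is \<open>m0 - norm m\<close>.\<close>

lemma norm_le_if_affine_nonneg:
  fixes m :: "real^3"
  assumes "\<And>n. norm n = 1 \<Longrightarrow> 0 \<le> m0 + n \<bullet> m"
  shows "norm m \<le> m0"
proof -
  obtain u where u: "norm u = 1" "m = norm m *\<^sub>R u" by (rule obtain_direction)
  have "u \<bullet> m = norm m" by (subst u(2)) (use u(1) in \<open>simp add: dot_square_norm\<close>)
  with assms[of "- u"] u(1) show ?thesis by simp
qed

text \<open>Positivity of the two effects on pure states gives \<open>norm m \<le> m0\<close> and
  \<open>norm m \<le> 1 - m0\<close>, where \<open>m0\<close> and \<open>m\<close> describe the
  expectation of \<open>M0\<close>. With \<open>b0 = 2 * m0 - 1\<close> and
  \<open>b = 2 *\<^sub>R m\<close> these two bounds together are the claimed constraint.\<close>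

lemma observable_expectation:
  assumes "two_outcome_observable B"
  obtains b0 :: real and b :: "real^3"
  where "\<bar>b0\<bar> + norm b \<le> 1" "\<And>n. Re (trace (bloch_state n ** B)) = b0 + n \<bullet> b"
proof -
  obtain M0 M1 where psd: "pos_semidef M0" "pos_semidef M1"
    and M: "M0 + M1 = mat 1" "B = M0 - M1"
    using assms by (auto simp: two_outcome_observable_def)
  obtain m0 m where m: "\<And>n. Re (trace (bloch_state n ** M0)) = m0 + n \<bullet> m"
    using trace_bloch_state_affine[of M0] by blast
  have M1: "Re (trace (bloch_state n ** M1)) = 1 - m0 - n \<bullet> m" for n
  proof -
    have "trace (bloch_state n ** M0) + trace (bloch_state n ** M1) = 1"
      by (simp add: M(1) trace_bloch_state flip: trace_add matrix_add_ldistrib)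
    then show ?thesis using m[of n] by (simp add: complex_eq_iff)
  qed
  have "norm m \<le> m0"
    using trace_pure_state_nonneg[OF psd(1)]
    by (intro norm_le_if_affine_nonneg) (simp add: pure_state_bloch_state flip: m)
  moreover have "norm (- m) \<le> 1 - m0"
    using trace_pure_state_nonneg[OF psd(2)]
    by (intro norm_le_if_affine_nonneg) (simp add: pure_state_bloch_state flip: M1)
  moreover have "Re (trace (bloch_state n ** B)) = 2 * m0 - 1 + n \<bullet> (2 *\<^sub>R m)" for n
  proof -
    have "M0 = B + M1" by (simp add: M(2))
    then have "trace (bloch_state n ** M0) = trace (bloch_state n ** B) + trace (bloch_state n ** M1)"
      by (simp add: matrix_add_ldistrib trace_add)
    then show ?thesis using m[of n] M1[of n] by simp
  qed
  ultimately show ?thesis using that[of "2 * m0 - 1" "2 *\<^sub>R m"] by simp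
qed

text \<open>A unit Bloch vector gives a rank-one projector, whose quadratic form at \<open>v\<close>
  is the squared modulus of the inner product of \<open>v\<close> with the ket.\<close>

lemma pos_semidef_bloch_state:
  assumes "norm u = 1"
  shows "pos_semidef (bloch_state u)"
proof -
  obtain \<psi> :: "complex^2" where \<psi>: "bloch_state u = (\<chi> i j. \<psi> $ i * cnj (\<psi> $ j))"
    using assms pure_state_bloch_state[of u] by (auto simp: pure_state_def)
  have "(\<Sum>i\<in>UNIV. cnj (v $ i) * (bloch_state u *v v) $ i)
      = of_real ((cmod (\<Sum>i\<in>UNIV. cnj (v $ i) * \<psi> $ i))\<^sup>2)" for v
    unfolding complex_norm_square
    by (simp add: \<psi> matrix_vector_mult_def sum_2 algebra_simps)
  then show ?thesis
    by (simp add: pos_semidef_def adj_mat_def \<psi> vec_eq_iff mult.commute)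
qed

text \<open>The two effects are the projectors with antipodal Bloch vectors, which sum to the
  identity. Their difference is the spin observable along \<open>u\<close>, with no bias and a
  vector part of length 1.\<close>

lemma spin_observable:
  assumes "norm u = 1"
  shows "two_outcome_observable (bloch_state u - bloch_state (- u))"
proof -
  have "bloch_state u + bloch_state (- u) = mat 1"
    by (simp add: bloch_state_def flip: scaleR_add_right scaleR_2)
  then show ?thesis
    using pos_semidef_bloch_state[of u] pos_semidef_bloch_state[of "- u"] assms
    unfolding two_outcome_observable_def by fastforce
qed

lemma trace_spin_observable:
  "Re (trace (bloch_state n ** (bloch_state u - bloch_state (- u)))) = n \<bullet> u"
  by (simp add: trace_def matrix_matrix_mult_def sum_2 sum_3 inner_vec_def bloch_state_entries
      field_simps)

section \<open>Optimizing a single witness over observables and the third state\<close>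

lemma I3_le_norms:
  assumes w: "0 \<le> w" "w \<le> 1"
    and B: "two_outcome_observable (B j1)" "two_outcome_observable (B j2)"
    and \<rho>: "\<rho> i1 = bloch_state m1" "\<rho> i2 = bloch_state m2" "\<rho> i3 = bloch_state m3"
    and m3: "norm m3 \<le> 1"
  shows "I3 (expectation_table \<rho> B) w i1 i2 i3 j1 j2
    \<le> w + (w * norm (m1 + m2) + (1 - w) * norm (m1 - m2))"
proof -
  obtain b0 b where b: "\<bar>b0\<bar> + norm b \<le> 1"
    "\<And>n. Re (trace (bloch_state n ** B j1)) = b0 + n \<bullet> b"
    using observable_expectation[OF B(1)] by blast
  obtain c0 c where c: "\<bar>c0\<bar> + norm c \<le> 1"
    "\<And>n. Re (trace (bloch_state n ** B j2)) = c0 + n \<bullet> c"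
    using observable_expectation[OF B(2)] by blast
  have "(m1 + m2 - m3) \<bullet> b \<le> norm (m1 + m2 - m3) * norm b" by (rule norm_cauchy_schwarz)
  \<comment> \<open>The Bloch vector of the third state lies in the unit ball, so it lengthens the
    sum by at most 1.\<close>
  also have "\<dots> \<le> (norm (m1 + m2) + 1) * norm b"
    using norm_triangle_ineq4[of "m1 + m2" m3] m3 by (intro mult_right_mono) auto
  \<comment> \<open>The bias \<open>b0\<close> enters with weight 1 + 1 - 1 = 1. The factor
    \<open>norm (m1 + m2) + 1\<close> is at least 1, so the bias is absorbed and the constraint on
    \<open>\<bar>b0\<bar> + norm b\<close> applies.\<close>
  finally have "b0 + (m1 + m2 - m3) \<bullet> b \<le> (norm (m1 + m2) + 1) * (\<bar>b0\<bar> + norm b)"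
    by (simp add: algebra_simps) (smt (verit) mult_nonneg_nonneg abs_ge_zero norm_ge_zero)
  also have "\<dots> \<le> norm (m1 + m2) + 1"
    using b(1) by (intro mult_left_le) auto
  finally have 1: "b0 + (m1 + m2 - m3) \<bullet> b \<le> norm (m1 + m2) + 1" .
  \<comment> \<open>The bias \<open>c0\<close> cancels in the difference of the two expectations, so
    it remains to bound the vector part \<open>c\<close>.\<close>
  have "(m1 - m2) \<bullet> c \<le> norm (m1 - m2) * norm c" by (rule norm_cauchy_schwarz)
  also have "\<dots> \<le> norm (m1 - m2)"
    using c(1) by (intro mult_left_le) auto
  finally have 2: "(m1 - m2) \<bullet> c \<le> norm (m1 - m2)" .
  have "I3 (expectation_table \<rho> B) w i1 i2 i3 j1 j2
      = w * (b0 + (m1 + m2 - m3) \<bullet> b) + (1 - w) * ((m1 - m2) \<bullet> c)"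
    by (simp add: I3_def expectation_table_def \<rho> b(2) c(2) inner_diff_left inner_add_left)
  also have "\<dots> \<le> w * (norm (m1 + m2) + 1) + (1 - w) * norm (m1 - m2)"
    using w by (intro add_mono mult_left_mono[OF 1] mult_left_mono[OF 2]) auto
  finally show ?thesis by (simp add: algebra_simps)
qed

section \<open>The Cauchy-Schwarz bound for the weighted norms and its equality case\<close>

lemma sum_squares_weights_pos: "0 < w\<^sup>2 + (1 - w)\<^sup>2" for w :: real
  by (simp add: sum_power2_gt_zero_iff)

text \<open>The point \<open>(2 * w / s, 2 * (1 - w) / s)\<close> has length 2 and the direction of
  the weights. Its squared distance from \<open>(a, b)\<close> is an explicit remainder in the
  Cauchy-Schwarz inequality: its sign gives the bound, its vanishing the equality case.\<close>

lemma cauchy_schwarz_defect: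
  fixes a b w :: real
  defines "s \<equiv> sqrt (w\<^sup>2 + (1 - w)\<^sup>2)"
  shows "(a - 2 * w / s)\<^sup>2 + (b - 2 * (1 - w) / s)\<^sup>2
    = a\<^sup>2 + b\<^sup>2 + 4 - 4 * (w * a + (1 - w) * b) / s"
proof -
  have s: "s > 0" "s\<^sup>2 = w\<^sup>2 + (1 - w)\<^sup>2"
    using sum_squares_weights_pos[of w] by (simp_all add: s_def)
  have "(2 * w / s)\<^sup>2 + (2 * (1 - w) / s)\<^sup>2 = 4 * (w\<^sup>2 + (1 - w)\<^sup>2) / s\<^sup>2"
    unfolding power_divide power_mult_distrib by (simp add: add_divide_distrib)
  also have "\<dots> = 4" unfolding s(2)[symmetric] using s(1) by simp
  finally have "(2 * w / s)\<^sup>2 + (2 * (1 - w) / s)\<^sup>2 = 4" .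
  moreover have "(a - p)\<^sup>2 + (b - q)\<^sup>2 = a\<^sup>2 + b\<^sup>2 + (p\<^sup>2 + q\<^sup>2) - 2 * (p * a + q * b)" for p q
    by (simp add: power2_eq_square algebra_simps)
  moreover have "2 * (2 * w / s * a + 2 * (1 - w) / s * b) = 4 * (w * a + (1 - w) * b) / s"
    using s(1) by (simp add: field_simps)
  ultimately show ?thesis by presburger
qed

text \<open>The parallelogram law and the polarization identity.\<close>

lemma norm_sum_diff_squares:
  fixes m1 m2 :: "'a::real_inner"
  shows "(norm (m1 + m2))\<^sup>2 + (norm (m1 - m2))\<^sup>2 = 2 * (norm m1)\<^sup>2 + 2 * (norm m2)\<^sup>2"
    and "(norm (m1 + m2))\<^sup>2 - (norm (m1 - m2))\<^sup>2 = 4 * (m1 \<bullet> m2)"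
  by (simp_all add: power2_norm_eq_inner inner_add inner_diff inner_commute)

text \<open>By the parallelogram law the squares of the two norms sum to at most 4, so nonnegativity
  of the defect bounds the weighted sum divided by \<open>s\<close> by 2.\<close>

lemma weighted_norms_le:
  fixes m1 m2 :: "'a::real_inner" and w :: real
  assumes m: "norm m1 \<le> 1" "norm m2 \<le> 1"
  shows "w * norm (m1 + m2) + (1 - w) * norm (m1 - m2) \<le> 2 * sqrt (w\<^sup>2 + (1 - w)\<^sup>2)"
proof -
  define s where "s = sqrt (w\<^sup>2 + (1 - w)\<^sup>2)"
  have s: "s > 0" using sum_squares_weights_pos[of w] by (simp add: s_def)
  have "(norm m1)\<^sup>2 \<le> 1" "(norm m2)\<^sup>2 \<le> 1" using m by (simp_all add: abs_square_le_1)
  then have "4 * (w * norm (m1 + m2) + (1 - w) * norm (m1 - m2)) / s \<le> 8"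
    using cauchy_schwarz_defect[of "norm (m1 + m2)" w "norm (m1 - m2)"]
      norm_sum_diff_squares(1)[of m1 m2]
      zero_le_power2[of "norm (m1 + m2) - 2 * w / s"]
      zero_le_power2[of "norm (m1 - m2) - 2 * (1 - w) / s"]
    unfolding s_def by linarith
  then show ?thesis using s by (simp add: s_def field_simps)
qed

text \<open>Equality turns the defect into
  \<open>2 * (norm m1)\<^sup>2 + 2 * (norm m2)\<^sup>2 - 4\<close>, which is at most 0. Being a sum
  of squares, the defect vanishes: both vectors have length 1, and the norms of their sum and
  difference are determined.\<close>

lemma weighted_norms_rigid:
  fixes m1 m2 :: "'a::real_inner" and w :: real
  assumes m: "norm m1 \<le> 1" "norm m2 \<le> 1"
    and eq: "w * norm (m1 + m2) + (1 - w) * norm (m1 - m2) = 2 * sqrt (w\<^sup>2 + (1 - w)\<^sup>2)"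
  shows "norm m1 = 1" "norm m2 = 1" "m1 \<bullet> m2 = (2 * w - 1) / (w\<^sup>2 + (1 - w)\<^sup>2)"
proof -
  define s where "s = sqrt (w\<^sup>2 + (1 - w)\<^sup>2)"
  have s: "s > 0" "s\<^sup>2 = w\<^sup>2 + (1 - w)\<^sup>2"
    using sum_squares_weights_pos[of w] by (simp_all add: s_def)
  have m2: "(norm m1)\<^sup>2 \<le> 1" "(norm m2)\<^sup>2 \<le> 1" using m by (simp_all add: abs_square_le_1)
  let ?a = "norm (m1 + m2)" and ?b = "norm (m1 - m2)"
  have defect: "(?a - 2 * w / s)\<^sup>2 + (?b - 2 * (1 - w) / s)\<^sup>2
      = 2 * (norm m1)\<^sup>2 + 2 * (norm m2)\<^sup>2 - 4"
    using s cauchy_schwarz_defect[of ?a w ?b] norm_sum_diff_squares(1)[of m1 m2]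
    by (simp add: eq flip: s_def)
  have nonneg: "0 \<le> (?a - 2 * w / s)\<^sup>2" "0 \<le> (?b - 2 * (1 - w) / s)\<^sup>2" by simp_all
  have "(norm m1)\<^sup>2 = 1" "(norm m2)\<^sup>2 = 1"
    using defect nonneg m2 by linarith+
  then show "norm m1 = 1" "norm m2 = 1"
    using norm_ge_zero[of m1] norm_ge_zero[of m2] by (simp_all add: power2_eq_1_iff)
  have "?a = 2 * w / s" "?b = 2 * (1 - w) / s"
    using defect nonneg m2 by (smt (verit) zero_eq_power2)+
  \<comment> \<open>Polarization recovers the inner product from the two norms.\<close>
  then have "4 * (m1 \<bullet> m2) = (2 * w / s)\<^sup>2 - (2 * (1 - w) / s)\<^sup>2"
    using norm_sum_diff_squares(2)[of m1 m2] by (simp only:)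
  also have "\<dots> = 4 * (w\<^sup>2 - (1 - w)\<^sup>2) / s\<^sup>2"
    unfolding power_divide power_mult_distrib by (simp add: diff_divide_distrib)
  also have "w\<^sup>2 - (1 - w)\<^sup>2 = 2 * w - 1"
    by (simp add: power2_eq_square algebra_simps)
  finally have "m1 \<bullet> m2 = (2 * w - 1) / s\<^sup>2"
    using s(1) by (simp add: field_simps)
  then show "m1 \<bullet> m2 = (2 * w - 1) / (w\<^sup>2 + (1 - w)\<^sup>2)"
    by (simp only: s(2))
qed

text \<open>The prescribed inner product makes the norms of the sum and the difference equal to
  \<open>2 * w / s\<close> and \<open>2 * (1 - w) / s\<close>, the point at which the Cauchy-Schwarz
  defect is zero.\<close>

lemma weighted_norms_eq:
  fixes m1 m2 :: "'a::real_inner"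
  assumes w: "0 \<le> w" "w \<le> 1" and m: "norm m1 = 1" "norm m2 = 1"
    and inner: "m1 \<bullet> m2 = (2 * w - 1) / (w\<^sup>2 + (1 - w)\<^sup>2)"
  shows "w * norm (m1 + m2) + (1 - w) * norm (m1 - m2) = 2 * sqrt (w\<^sup>2 + (1 - w)\<^sup>2)"
proof -
  define s where "s = sqrt (w\<^sup>2 + (1 - w)\<^sup>2)"
  have s: "s > 0" "s\<^sup>2 = w\<^sup>2 + (1 - w)\<^sup>2"
    using sum_squares_weights_pos[of w] by (simp_all add: s_def)
  have x: "s\<^sup>2 * (m1 \<bullet> m2) = 2 * w - 1" using s by (simp add: inner flip: s(2))
  have sq: "(norm (m1 + m2))\<^sup>2 = 2 + 2 * (m1 \<bullet> m2)" "(norm (m1 - m2))\<^sup>2 = 2 - 2 * (m1 \<bullet> m2)"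
    using norm_sum_diff_squares[of m1 m2] m by simp_all
  have "(s * norm (m1 + m2))\<^sup>2 = 2 * s\<^sup>2 + 2 * (s\<^sup>2 * (m1 \<bullet> m2))"
    by (simp add: power_mult_distrib sq algebra_simps)
  also have "\<dots> = (2 * w)\<^sup>2" unfolding x unfolding s(2) by (simp add: power2_eq_square algebra_simps)
  \<comment> \<open>Squares determine the values because both sides are nonnegative; here this uses
    \<open>0 \<le> w\<close>, and for the difference below \<open>w \<le> 1\<close>.\<close>
  finally have a: "s * norm (m1 + m2) = 2 * w"
    by (rule power2_eq_imp_eq) (use s w in simp_all)
  have "(s * norm (m1 - m2))\<^sup>2 = 2 * s\<^sup>2 - 2 * (s\<^sup>2 * (m1 \<bullet> m2))"
    by (simp add: power_mult_distrib sq algebra_simps)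
  also have "\<dots> = (2 * (1 - w))\<^sup>2" unfolding x unfolding s(2) by (simp add: power2_eq_square algebra_simps)
  finally have b: "s * norm (m1 - m2) = 2 * (1 - w)"
    by (rule power2_eq_imp_eq) (use s w in simp_all)
  have "s * (w * norm (m1 + m2) + (1 - w) * norm (m1 - m2))
      = w * (s * norm (m1 + m2)) + (1 - w) * (s * norm (m1 - m2))"
    by (simp add: algebra_simps)
  also have "\<dots> = s * (2 * s)"
    unfolding a b using s(2) by (simp add: power2_eq_square algebra_simps)
  finally have "w * norm (m1 + m2) + (1 - w) * norm (m1 - m2) = 2 * s"
    using s(1) by simp
  then show ?thesis by (simp only: s_def)
qed

section \<open>The sharp bound for a single witness, its rigidity and its attainment\<close>

lemma I3_le:
  assumes "qubit_realization \<rho> B" "0 \<le> w" "w \<le> 1" "{i1, i2, i3, j1, j2} \<subseteq> {1..6}"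
  shows "I3 (expectation_table \<rho> B) w i1 i2 i3 j1 j2 \<le> 2 * sqrt (w\<^sup>2 + (1 - w)\<^sup>2) + w"
    and "I3 (expectation_table \<rho> B) w i1 i2 i3 j1 j2 = 2 * sqrt (w\<^sup>2 + (1 - w)\<^sup>2) + w \<Longrightarrow>
      pure_state (\<rho> i1) \<and> pure_state (\<rho> i2) \<and>
      bloch_vector (\<rho> i1) \<bullet> bloch_vector (\<rho> i2) = (2 * w - 1) / (w\<^sup>2 + (1 - w)\<^sup>2)"
proof -
  have q: "qubit_state (\<rho> i1)" "qubit_state (\<rho> i2)" "qubit_state (\<rho> i3)"
    "two_outcome_observable (B j1)" "two_outcome_observable (B j2)"
    using assms(1,4) unfolding qubit_realization_def by blast+
  obtain m1 m2 m3 where m: "norm m1 \<le> 1" "norm m2 \<le> 1" "norm m3 \<le> 1"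
    and \<rho>: "\<rho> i1 = bloch_state m1" "\<rho> i2 = bloch_state m2" "\<rho> i3 = bloch_state m3"
    using q(1-3) unfolding qubit_state_def by blast
  note I3 = I3_le_norms[OF assms(2,3) q(4,5) \<rho> m(3)]
  note CS = weighted_norms_le[OF m(1,2), of w]
  show "I3 (expectation_table \<rho> B) w i1 i2 i3 j1 j2 \<le> 2 * sqrt (w\<^sup>2 + (1 - w)\<^sup>2) + w"
    using I3 CS by linarith
  assume "I3 (expectation_table \<rho> B) w i1 i2 i3 j1 j2 = 2 * sqrt (w\<^sup>2 + (1 - w)\<^sup>2) + w"
  \<comment> \<open>The witness lies below the weighted norms plus \<open>w\<close>, which lie below
    the bound; a maximal witness makes both inequalities tight.\<close>
  then have "w * norm (m1 + m2) + (1 - w) * norm (m1 - m2) = 2 * sqrt (w\<^sup>2 + (1 - w)\<^sup>2)"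
    using I3 CS by linarith
  from weighted_norms_rigid[OF m(1,2) this]
  show "pure_state (\<rho> i1) \<and> pure_state (\<rho> i2) \<and>
      bloch_vector (\<rho> i1) \<bullet> bloch_vector (\<rho> i2) = (2 * w - 1) / (w\<^sup>2 + (1 - w)\<^sup>2)"
    by (simp add: \<rho> pure_state_bloch_state)
qed

text \<open>The vectors \<open>b\<close> and \<open>c\<close> are taken along \<open>m1 + m2\<close>
  and \<open>m1 - m2\<close>. The term \<open>b \<bullet> b\<close> is the contribution of a third
  state with Bloch vector \<open>- b\<close>, which enters the witness with a minus sign.\<close>

lemma obtain_optimal_directions:
  fixes m1 m2 :: "real^3"
  assumes "0 \<le> w" "w \<le> 1" "norm m1 = 1" "norm m2 = 1"
    and "m1 \<bullet> m2 = (2 * w - 1) / (w\<^sup>2 + (1 - w)\<^sup>2)"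
  obtains b c where "norm b = 1" "norm c = 1"
    "w * (m1 \<bullet> b + m2 \<bullet> b + b \<bullet> b) + (1 - w) * (m1 \<bullet> c - m2 \<bullet> c)
      = 2 * sqrt (w\<^sup>2 + (1 - w)\<^sup>2) + w"
proof -
  obtain b where b: "norm b = 1" "m1 + m2 = norm (m1 + m2) *\<^sub>R b" by (rule obtain_direction)
  obtain c where c: "norm c = 1" "m1 - m2 = norm (m1 - m2) *\<^sub>R c" by (rule obtain_direction)
  have "(m1 + m2) \<bullet> b = norm (m1 + m2)"
    by (subst b(2)) (use b(1) in \<open>simp add: dot_square_norm\<close>)
  moreover have "(m1 - m2) \<bullet> c = norm (m1 - m2)"
    by (subst c(2)) (use c(1) in \<open>simp add: dot_square_norm\<close>)
  moreover have "b \<bullet> b = 1" using b(1) by (simp add: dot_square_norm)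
  ultimately have "w * (m1 \<bullet> b + m2 \<bullet> b + b \<bullet> b) + (1 - w) * (m1 \<bullet> c - m2 \<bullet> c)
      = w * (norm (m1 + m2) + 1) + (1 - w) * norm (m1 - m2)"
    by (simp add: inner_add_left inner_diff_left)
  with that[OF b(1) c(1)] weighted_norms_eq[OF assms] show ?thesis
    by (simp add: algebra_simps)
qed

section \<open>The maximum of the combined witness and self-testing of the triple\<close>

theorem mainTheorem1:
  fixes n :: "nat \<Rightarrow> real^3" and \<omega> :: "nat \<Rightarrow> nat \<Rightarrow> real"
  assumes unit: "\<forall>i\<in>{1..3}. norm (n i) = 1"
    and one_antipodal: "card {(i, j) \<in> index_pairs. n i \<bullet> n j = - 1} \<le> 1"
    and remaining: "\<forall>(i, j)\<in>index_pairs. n i \<bullet> n j \<noteq> - 1 \<longrightarrow> \<bar>n i \<bullet> n j\<bar> < 1"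
    and omega: "\<forall>(i, j)\<in>index_pairs. 0 \<le> \<omega> i j \<and> \<omega> i j \<le> 1 \<and>
      n i \<bullet> n j = (2 * \<omega> i j - 1) / ((\<omega> i j)\<^sup>2 + (1 - \<omega> i j)\<^sup>2)"
  shows "Q_max (\<omega> 1 2) (\<omega> 1 3) (\<omega> 2 3) \<in> witness_values (\<omega> 1 2) (\<omega> 1 3) (\<omega> 2 3) \<and>
    (\<forall>q \<in> witness_values (\<omega> 1 2) (\<omega> 1 3) (\<omega> 2 3). q \<le> Q_max (\<omega> 1 2) (\<omega> 1 3) (\<omega> 2 3)) \<and>
    Q_max (\<omega> 1 2) (\<omega> 1 3) (\<omega> 2 3) =
      (\<Sum>(i, j)\<in>index_pairs. 2 * sqrt ((\<omega> i j)\<^sup>2 + (1 - \<omega> i j)\<^sup>2) + \<omega> i j) \<and>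
    (\<forall>\<rho> B. qubit_realization \<rho> B \<and>
        I6 (expectation_table \<rho> B) (\<omega> 1 2) (\<omega> 1 3) (\<omega> 2 3) = Q_max (\<omega> 1 2) (\<omega> 1 3) (\<omega> 2 3) \<longrightarrow>
      (\<forall>i\<in>{1..3}. pure_state (\<rho> i)) \<and>
      (\<forall>i j. 1 \<le> i \<and> i < j \<and> j \<le> 3 \<longrightarrow>
        bloch_vector (\<rho> i) \<bullet> bloch_vector (\<rho> j) = n i \<bullet> n j))"
proof -
  let ?g = "\<lambda>w::real. 2 * sqrt (w\<^sup>2 + (1 - w)\<^sup>2) + w"
  let ?W = "witness_values (\<omega> 1 2) (\<omega> 1 3) (\<omega> 2 3)"
  let ?Q = "?g (\<omega> 1 2) + ?g (\<omega> 1 3) + ?g (\<omega> 2 3)"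
  have \<omega>: "0 \<le> \<omega> 1 2" "\<omega> 1 2 \<le> 1" "0 \<le> \<omega> 1 3" "\<omega> 1 3 \<le> 1" "0 \<le> \<omega> 2 3" "\<omega> 2 3 \<le> 1"
    and inner: "n 1 \<bullet> n 2 = (2 * \<omega> 1 2 - 1) / ((\<omega> 1 2)\<^sup>2 + (1 - \<omega> 1 2)\<^sup>2)"
      "n 1 \<bullet> n 3 = (2 * \<omega> 1 3 - 1) / ((\<omega> 1 3)\<^sup>2 + (1 - \<omega> 1 3)\<^sup>2)"
      "n 2 \<bullet> n 3 = (2 * \<omega> 2 3 - 1) / ((\<omega> 2 3)\<^sup>2 + (1 - \<omega> 2 3)\<^sup>2)"
    using omega by (simp_all add: index_pairs_def)
  have n: "norm (n 1) = 1" "norm (n 2) = 1" "norm (n 3) = 1" using unit by simp_all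
  have six: "{1..6} = {1, 2, 3, 4, 5, 6 :: nat}" by auto
  have three: "{1..3} = {1, 2, 3 :: nat}" by auto
  have le: "I6 (expectation_table \<rho> B) (\<omega> 1 2) (\<omega> 1 3) (\<omega> 2 3) \<le> ?Q"
    and rigid: "I6 (expectation_table \<rho> B) (\<omega> 1 2) (\<omega> 1 3) (\<omega> 2 3) = ?Q \<Longrightarrow>
      (\<forall>i\<in>{1..3}. pure_state (\<rho> i)) \<and>
      bloch_vector (\<rho> 1) \<bullet> bloch_vector (\<rho> 2) = n 1 \<bullet> n 2 \<and>
      bloch_vector (\<rho> 1) \<bullet> bloch_vector (\<rho> 3) = n 1 \<bullet> n 3 \<and>
      bloch_vector (\<rho> 2) \<bullet> bloch_vector (\<rho> 3) = n 2 \<bullet> n 3"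
    if "qubit_realization \<rho> B" for \<rho> B
  proof -
    have index: "{1, 2, 4, 1, 2} \<subseteq> {1..6::nat}" "{1, 3, 5, 3, 4} \<subseteq> {1..6::nat}"
      "{2, 3, 6, 5, 6} \<subseteq> {1..6::nat}" by auto
    note I3_12 = I3_le[OF that \<omega>(1,2) index(1)]
    note I3_13 = I3_le[OF that \<omega>(3,4) index(2)]
    note I3_23 = I3_le[OF that \<omega>(5,6) index(3)]
    show "I6 (expectation_table \<rho> B) (\<omega> 1 2) (\<omega> 1 3) (\<omega> 2 3) \<le> ?Q"
      unfolding I6_def using I3_12(1) I3_13(1) I3_23(1) by linarith
    assume "I6 (expectation_table \<rho> B) (\<omega> 1 2) (\<omega> 1 3) (\<omega> 2 3) = ?Q"
    \<comment> \<open>No summand exceeds its own bound, so reaching the sum of the bounds forces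
      equality in each.\<close>
    then have
      "I3 (expectation_table \<rho> B) (\<omega> 1 2) 1 2 4 1 2 = ?g (\<omega> 1 2)"
      "I3 (expectation_table \<rho> B) (\<omega> 1 3) 1 3 5 3 4 = ?g (\<omega> 1 3)"
      "I3 (expectation_table \<rho> B) (\<omega> 2 3) 2 3 6 5 6 = ?g (\<omega> 2 3)"
      unfolding I6_def using I3_12(1) I3_13(1) I3_23(1) by linarith+
    then show "(\<forall>i\<in>{1..3}. pure_state (\<rho> i)) \<and>
      bloch_vector (\<rho> 1) \<bullet> bloch_vector (\<rho> 2) = n 1 \<bullet> n 2 \<and>
      bloch_vector (\<rho> 1) \<bullet> bloch_vector (\<rho> 3) = n 1 \<bullet> n 3 \<and>
      bloch_vector (\<rho> 2) \<bullet> bloch_vector (\<rho> 3) = n 2 \<bullet> n 3"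
      unfolding three inner using I3_12(2) I3_13(2) I3_23(2) by simp
  qed
  have attained: "?Q \<in> ?W"
  proof -
    obtain b1 b2 where b12: "norm b1 = 1" "norm b2 = 1"
      "\<omega> 1 2 * (n 1 \<bullet> b1 + n 2 \<bullet> b1 + b1 \<bullet> b1) + (1 - \<omega> 1 2) * (n 1 \<bullet> b2 - n 2 \<bullet> b2) = ?g (\<omega> 1 2)"
      using obtain_optimal_directions[OF \<omega>(1,2) n(1,2) inner(1)] by blast
    obtain b3 b4 where b34: "norm b3 = 1" "norm b4 = 1"
      "\<omega> 1 3 * (n 1 \<bullet> b3 + n 3 \<bullet> b3 + b3 \<bullet> b3) + (1 - \<omega> 1 3) * (n 1 \<bullet> b4 - n 3 \<bullet> b4) = ?g (\<omega> 1 3)"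
      using obtain_optimal_directions[OF \<omega>(3,4) n(1,3) inner(2)] by blast
    obtain b5 b6 where b56: "norm b5 = 1" "norm b6 = 1"
      "\<omega> 2 3 * (n 2 \<bullet> b5 + n 3 \<bullet> b5 + b5 \<bullet> b5) + (1 - \<omega> 2 3) * (n 2 \<bullet> b6 - n 3 \<bullet> b6) = ?g (\<omega> 2 3)"
      using obtain_optimal_directions[OF \<omega>(5,6) n(2,3) inner(3)] by blast
    \<comment> \<open>States 1 to 3 are the targets. Each summand has its own third state and its
      own pair of observables, so choosing these optimally for one summand leaves the other two
      unchanged.\<close>
    define m where "m = n(4 := - b1, 5 := - b3, 6 := - b5)"
    define b :: "nat \<Rightarrow> real^3" where "b = (\<lambda>_. 0)(1 := b1, 2 := b2, 3 := b3, 4 := b4, 5 := b5, 6 := b6)"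
    define \<rho> where "\<rho> = (\<lambda>x. bloch_state (m x))"
    define B where "B = (\<lambda>y. bloch_state (b y) - bloch_state (- b y))"
    have "\<forall>x\<in>{1..6}. norm (m x) = 1" "\<forall>y\<in>{1..6}. norm (b y) = 1"
      unfolding six m_def b_def using n b12 b34 b56 by simp_all
    then have "qubit_realization \<rho> B"
      unfolding qubit_realization_def \<rho>_def B_def qubit_state_def
      using spin_observable by (metis order_refl)
    moreover have "expectation_table \<rho> B x y = m x \<bullet> b y" for x y
      by (simp add: expectation_table_def \<rho>_def B_def trace_spin_observable)
    then have "I6 (expectation_table \<rho> B) (\<omega> 1 2) (\<omega> 1 3) (\<omega> 2 3) = ?Q"
      using b12(3) b34(3) b56(3) by (simp add: I6_def I3_def m_def b_def)
    ultimately show ?thesis unfolding witness_values_def mem_Collect_eq by metis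
  qed
  have max: "q \<le> ?Q" if "q \<in> ?W" for q
    using that le by (auto simp: witness_values_def)
  \<comment> \<open>Attainment together with the upper bound makes the value the greatest element,
    which identifies \<open>Q_max\<close>.\<close>
  have Q: "Q_max (\<omega> 1 2) (\<omega> 1 3) (\<omega> 2 3) = ?Q"
    unfolding Q_max_def using attained max by (intro Greatest_equality)
  have pairs: "(i = 1 \<and> j = 2) \<or> (i = 1 \<and> j = 3) \<or> (i = 2 \<and> j = 3)"
    if "1 \<le> i \<and> i < j \<and> j \<le> 3" for i j :: nat
    using that by linarith
  show ?thesis
  proof (intro conjI allI impI)
    show "Q_max (\<omega> 1 2) (\<omega> 1 3) (\<omega> 2 3) \<in> ?W" using attained by (simp only: Q)
    show "\<forall>q\<in>?W. q \<le> Q_max (\<omega> 1 2) (\<omega> 1 3) (\<omega> 2 3)" unfolding Q using max by blast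
    show "Q_max (\<omega> 1 2) (\<omega> 1 3) (\<omega> 2 3) =
        (\<Sum>(i, j)\<in>index_pairs. 2 * sqrt ((\<omega> i j)\<^sup>2 + (1 - \<omega> i j)\<^sup>2) + \<omega> i j)"
      unfolding Q by (simp add: index_pairs_def)
  next
    fix \<rho> B
    assume A: "qubit_realization \<rho> B \<and>
      I6 (expectation_table \<rho> B) (\<omega> 1 2) (\<omega> 1 3) (\<omega> 2 3) = Q_max (\<omega> 1 2) (\<omega> 1 3) (\<omega> 2 3)"
    then have R: "(\<forall>i\<in>{1..3}. pure_state (\<rho> i)) \<and>
      bloch_vector (\<rho> 1) \<bullet> bloch_vector (\<rho> 2) = n 1 \<bullet> n 2 \<and>
      bloch_vector (\<rho> 1) \<bullet> bloch_vector (\<rho> 3) = n 1 \<bullet> n 3 \<and>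
      bloch_vector (\<rho> 2) \<bullet> bloch_vector (\<rho> 3) = n 2 \<bullet> n 3"
      unfolding Q using rigid by blast
    then show "\<forall>i\<in>{1..3}. pure_state (\<rho> i)" by blast
    fix i j :: nat
    assume "1 \<le> i \<and> i < j \<and> j \<le> 3"
    from pairs[OF this] R show "bloch_vector (\<rho> i) \<bullet> bloch_vector (\<rho> j) = n i \<bullet> n j" by auto
  qed
qed

end
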